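(* Let $n\ge1$. There is a complete order isomorphism between the operator system $C(S^1)^{(n)}$ of $n\times n$ complex Toeplitz matrices and the dual $(C^*(\mathbb Z)_{(n)})^d$ of the Fejér--Riesz operator system $C^*(\mathbb Z)_{(n)}$. For any Toeplitz matrix $T=(t_{k-l})_{k,l}$ the corresponding functional $\phi_T\in(C^*(\mathbb Z)_{(n)})^d$ is given by $$\phi_T(a)=\sum_ka_kt_{-k},\qquad a=(a_k)\in C^*(\mathbb Z)_{(n)}.$$
   Context: $C(S^1)^{(n)}\subset M_n(\mathbb C)$ is the operator system of matrices $T=(t_{k-l})_{k,l}$ with $t_j\in\mathbb C$, $|j|\le n-1$, with the matrix order inherited from $M_n(\mathbb C)$. $C^*(\mathbb Z)_{(n)}=\{a=(a_k)_{k\in\mathbb Z}:\mathrm{supp}(a)\subset(-n,n)\}$, an operator subsystem of the convolution $C^*$-algebra $C^*(\mathbb Z)\cong C(S^1)$ via $a\mapsto\sum_ka_kz^k$, with $a_k^*=\overline{a_{-k}}$. For a finite-dimensional operator system $E$, the dual $E^d$ is the dual vector space with matrix order $$M_m(E^d)_+=\{\phi=(\phi_{ij})\in M_m(E^d):\ \sum_{i,j}\phi_{ij}(x_{ij})\ge0\ \text{ for all }x=(x_{ij})\in M_m(E)_+\}$$ (a faithful state on $E$ provides an Archimedean order unit). A complete order isomorphism is an invertible linear map such that it and its inverse are completely positive, i.e. map positive $m\times m$ matrices to positive $m\times m$ matrices for all $m$. *)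

theory Defs
  imports Complex_Main "HOL-Library.FuncSet" "Jordan_Normal_Form.Matrix"
begin

section \<open>Matrix-ordered complex vector spaces\<close>

text \<open>
  The data of an operator system that complete order isomorphisms refer to: a complex vector space,
  given by a carrier and its operations, and for each m the cone of positive m by m matrices over it.
  Neither the involution nor the order unit enters the notion of complete order isomorphism, so
  they are not part of the record.
\<close>

record 'e mos =
  elems :: "'e set"
  plus_of :: "'e \<Rightarrow> 'e \<Rightarrow> 'e"
  scale_of :: "complex \<Rightarrow> 'e \<Rightarrow> 'e"
  pos_cone :: "nat \<Rightarrow> 'e mat set"

definition mats_over :: "'e set \<Rightarrow> nat \<Rightarrow> 'e mat set" where
  "mats_over E m = {X \<in> carrier_mat m m. \<forall>i<m. \<forall>j<m. X $$ (i, j) \<in> E}"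

definition linear_between :: "'a mos \<Rightarrow> 'b mos \<Rightarrow> ('a \<Rightarrow> 'b) \<Rightarrow> bool" where
  "linear_between E F f \<longleftrightarrow>
     (\<forall>x\<in>elems E. f x \<in> elems F) \<and>
     (\<forall>x\<in>elems E. \<forall>y\<in>elems E. f (plus_of E x y) = plus_of F (f x) (f y)) \<and>
     (\<forall>c. \<forall>x\<in>elems E. f (scale_of E c x) = scale_of F c (f x))"

definition completely_positive :: "'a mos \<Rightarrow> 'b mos \<Rightarrow> ('a \<Rightarrow> 'b) \<Rightarrow> bool" where
  "completely_positive E F f \<longleftrightarrow> (\<forall>m. \<forall>X\<in>pos_cone E m. map_mat f X \<in> pos_cone F m)"

definition complete_order_iso :: "'a mos \<Rightarrow> 'b mos \<Rightarrow> ('a \<Rightarrow> 'b) \<Rightarrow> bool" where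
  "complete_order_iso E F f \<longleftrightarrow>
     linear_between E F f \<and> bij_betw f (elems E) (elems F) \<and>
     completely_positive E F f \<and> completely_positive F E (inv_into (elems E) f)"

section \<open>Duals\<close>

text \<open>
  Functionals are taken to be \<^const>\<open>undefined\<close> off the carrier, so that equality of functionals is
  equality on the carrier. Here and below, \<open>0 \<le> z\<close> for a complex number means that z is
  real and nonnegative.
\<close>

definition functionals :: "'e mos \<Rightarrow> ('e \<Rightarrow> complex) set" where
  "functionals E = {\<phi> \<in> extensional (elems E).
     (\<forall>x\<in>elems E. \<forall>y\<in>elems E. \<phi> (plus_of E x y) = \<phi> x + \<phi> y) \<and>
     (\<forall>c. \<forall>x\<in>elems E. \<phi> (scale_of E c x) = c * \<phi> x)}"

definition dual_system :: "'e mos \<Rightarrow> ('e \<Rightarrow> complex) mos" where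
  "dual_system E = \<lparr>
     elems = functionals E,
     plus_of = (\<lambda>\<phi> \<psi>. \<lambda>x\<in>elems E. \<phi> x + \<psi> x),
     scale_of = (\<lambda>c \<phi>. \<lambda>x\<in>elems E. c * \<phi> x),
     pos_cone = (\<lambda>m. {\<Phi> \<in> mats_over (functionals E) m.
       \<forall>X\<in>pos_cone E m. 0 \<le> (\<Sum>i<m. \<Sum>j<m. (\<Phi> $$ (i, j)) (X $$ (i, j)))}) \<rparr>"

section \<open>Toeplitz matrices\<close>

text \<open>Over the complex numbers, nonnegativity of the quadratic form already forces A to be Hermitian.\<close>

definition psd :: "complex mat \<Rightarrow> bool" where
  "psd A \<longleftrightarrow> square_mat A \<and> (\<forall>v\<in>carrier_vec (dim_row A). 0 \<le> (A *\<^sub>v v) \<bullet>c v)"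

text \<open>The identification of m by m matrices over the n by n matrices with block matrices of size mn.\<close>

definition flatten_blocks :: "nat \<Rightarrow> nat \<Rightarrow> complex mat mat \<Rightarrow> complex mat" where
  "flatten_blocks m n X =
     mat (m * n) (m * n) (\<lambda>(r, s). (X $$ (r div n, s div n)) $$ (r mod n, s mod n))"

definition toeplitz_mat :: "nat \<Rightarrow> (int \<Rightarrow> complex) \<Rightarrow> complex mat" where
  "toeplitz_mat n t = mat n n (\<lambda>(k, l). t (int k - int l))"

definition toeplitz_system :: "nat \<Rightarrow> complex mat mos" where
  "toeplitz_system n = \<lparr>
     elems = range (toeplitz_mat n),
     plus_of = (+),
     scale_of = (\<cdot>\<^sub>m),
     pos_cone = (\<lambda>m. {X \<in> mats_over (range (toeplitz_mat n)) m. psd (flatten_blocks m n X)}) \<rparr>"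

section \<open>The Fejer--Riesz system\<close>

definition fr_sequences :: "nat \<Rightarrow> (int \<Rightarrow> complex) set" where
  "fr_sequences n = {a. \<forall>k. a k \<noteq> 0 \<longrightarrow> k \<in> {- int n<..<int n}}"

text \<open>The function on the unit circle corresponding to a sequence supported in (-n, n).\<close>

definition symbol :: "nat \<Rightarrow> (int \<Rightarrow> complex) \<Rightarrow> complex \<Rightarrow> complex" where
  "symbol n a z = (\<Sum>k\<in>{- int n<..<int n}. a k * z powi k)"

text \<open>
  The positive cone of the m by m matrices over the continuous functions on the circle, viewed as
  the C*-algebra of continuous matrix-valued functions with pointwise operations.
\<close>

definition circle_cone :: "nat \<Rightarrow> (complex \<Rightarrow> complex) mat set" where
  "circle_cone m = {F \<in> mats_over {f. continuous_on {z. cmod z = 1} f} m.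
     \<forall>z. cmod z = 1 \<longrightarrow> psd (map_mat (\<lambda>f. f z) F)}"

definition fejer_riesz_system :: "nat \<Rightarrow> (int \<Rightarrow> complex) mos" where
  "fejer_riesz_system n = \<lparr>
     elems = fr_sequences n,
     plus_of = (\<lambda>a b k. a k + b k),
     scale_of = (\<lambda>c a k. c * a k),
     pos_cone = (\<lambda>m. {X \<in> mats_over (fr_sequences n) m. map_mat (symbol n) X \<in> circle_cone m}) \<rparr>"

end

(*
  For a column vector v, the pairing of T with the rank one symbol A(z) = b(z) b(z)^* built from v is
  the quadratic form of T at v, so a functional that is positive on the Fejer--Riesz system comes from
  a positive block Toeplitz matrix.

  The converse avoids the operator-valued Fejer--Riesz factorisation. A positive T is perturbed to a
  positive definite block Toeplitz matrix, and this one extends to positive definite block Toeplitz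
  matrices of every size N: one new diagonal at a time, by positive definite completion. The
  Fejer sums F(z) = sum_{k,l<N} t_{k-l} z^{k-l} of an extension are positive definite on the circle,
  so the Schur product theorem gives sum_{i,j} A_{ij}(z) F_{ij}(z) >= 0. Averaging over the roots of
  unity of order 2N yields sum_k (N - |k|) sum_{i,j} a^{ij}_k t^{ij}_{-k} >= 0, and N -> oo gives
  positivity of the pairing.
*)

theory Submission
  imports Defs
begin

section \<open>Positive definite matrices over finite index sets\<close>

text \<open>Arbitrary index types let the same notions serve for matrix levels and for pairs of
  block index and position, and allow inductions that insert one index at a time. Vectors are total
  functions of which only the values on \<open>I\<close> matter.\<close>

definition qf :: "'i set \<Rightarrow> ('i \<Rightarrow> 'i \<Rightarrow> complex) \<Rightarrow> ('i \<Rightarrow> complex) \<Rightarrow> complex" where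
  "qf I A v = (\<Sum>i\<in>I. \<Sum>j\<in>I. A i j * v j * cnj (v i))"

definition psd_on :: "'i set \<Rightarrow> ('i \<Rightarrow> 'i \<Rightarrow> complex) \<Rightarrow> bool" where
  "psd_on I A \<longleftrightarrow> (\<forall>v. 0 \<le> qf I A v)"

definition hermitian_on :: "'i set \<Rightarrow> ('i \<Rightarrow> 'i \<Rightarrow> complex) \<Rightarrow> bool" where
  "hermitian_on I A \<longleftrightarrow> (\<forall>i\<in>I. \<forall>j\<in>I. cnj (A i j) = A j i)"

definition pd_on :: "'i set \<Rightarrow> ('i \<Rightarrow> 'i \<Rightarrow> complex) \<Rightarrow> bool" where
  "pd_on I A \<longleftrightarrow> hermitian_on I A \<and> (\<forall>v. (\<exists>i\<in>I. v i \<noteq> 0) \<longrightarrow> 0 < qf I A v)"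

definition schur_complement :: "('i \<Rightarrow> 'i \<Rightarrow> complex) \<Rightarrow> 'i \<Rightarrow> 'i \<Rightarrow> 'i \<Rightarrow> complex" where
  "schur_complement A s = (\<lambda>i j. A i j - A i s * A s j / A s s)"

lemma qf_cong:
  assumes "\<And>i j. i \<in> I \<Longrightarrow> j \<in> I \<Longrightarrow> A i j = B i j" "\<And>i. i \<in> I \<Longrightarrow> v i = w i"
  shows "qf I A v = qf I B w"
  unfolding qf_def using assms by (auto intro!: sum.cong)

lemma pd_on_cong:
  assumes "\<And>i j. i \<in> I \<Longrightarrow> j \<in> I \<Longrightarrow> A i j = B i j"
  shows "pd_on I A \<longleftrightarrow> pd_on I B"
proof -
  have "qf I A v = qf I B v" for v
    using assms by (intro qf_cong) auto
  then show ?thesis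
    unfolding pd_on_def hermitian_on_def using assms by simp
qed

section \<open>Pivots and Schur complements\<close>

lemma qf_insert:
  assumes "finite S" "s \<notin> S"
  shows "qf (insert s S) A v = qf S A v + (\<Sum>i\<in>S. A i s * cnj (v i)) * v s
    + (\<Sum>j\<in>S. A s j * v j) * cnj (v s) + A s s * v s * cnj (v s)"
  unfolding qf_def using assms
  by (simp add: sum.distrib sum_distrib_left sum_distrib_right algebra_simps)

lemma qf_schur_complement:
  "qf S (schur_complement A s) v
    = qf S A v - (\<Sum>i\<in>S. A i s * cnj (v i)) * (\<Sum>j\<in>S. A s j * v j) / A s s"
  unfolding qf_def schur_complement_def
  by (simp only: sum_product sum_divide_distrib sum_subtractf [symmetric])
    (simp add: algebra_simps)

text \<open>Completing the square in the coordinate \<open>v s\<close>: the mixed terms go into the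
  square, and what it leaves over turns the form on \<open>S\<close> into that of the Schur
  complement.\<close>

lemma qf_insert_hermitian:
  assumes "finite S" "s \<notin> S" "hermitian_on (insert s S) A" "A s s \<noteq> 0"
  shows "qf (insert s S) A v = qf S (schur_complement A s) v
    + A s s * (cmod (v s + (\<Sum>j\<in>S. A s j * v j) / A s s))\<^sup>2"
proof -
  let ?x = "\<Sum>j\<in>S. A s j * v j"
  have y: "(\<Sum>i\<in>S. A i s * cnj (v i)) = cnj ?x"
    using assms(3) by (auto simp: hermitian_on_def intro!: sum.cong)
  have r: "cnj (A s s) = A s s"
    using assms(3) by (simp add: hermitian_on_def)
  show ?thesis
    unfolding qf_insert[OF assms(1,2)] qf_schur_complement y complex_norm_square
    using assms(4) by (simp add: r field_simps)
qed

lemma hermitian_schur_complement: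
  assumes "hermitian_on (insert s S) A"
  shows "hermitian_on S (schur_complement A s)"
  using assms by (auto simp: hermitian_on_def schur_complement_def mult.commute)

text \<open>Both directions read off the completed square of \<open>qf_insert_hermitian\<close>.
  This is the induction step for the completion and for the Schur product.\<close>

lemma pd_on_insert_iff:
  assumes "finite S" "s \<notin> S"
  shows "pd_on (insert s S) A \<longleftrightarrow>
    hermitian_on (insert s S) A \<and> 0 < A s s \<and> pd_on S (schur_complement A s)"
proof (intro iffI conjI; (elim conjE)?)
  assume pd: "pd_on (insert s S) A"
  then show h: "hermitian_on (insert s S) A" by (simp add: pd_on_def)
  let ?e = "\<lambda>i. if i = s then 1 else 0"
  have "0 < qf (insert s S) A ?e"
    using pd by (auto simp: pd_on_def)
  also have "\<dots> = A s s"
  proof -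
    have "qf S A ?e = 0" "(\<Sum>i\<in>S. A i s * cnj (?e i)) = 0" "(\<Sum>j\<in>S. A s j * ?e j) = 0"
      using assms by (auto simp: qf_def intro!: sum.neutral)
    then show ?thesis unfolding qf_insert[OF assms] by simp
  qed
  finally show pos: "0 < A s s" .
  show "pd_on S (schur_complement A s)"
    unfolding pd_on_def
  proof (intro conjI allI impI)
    show "hermitian_on S (schur_complement A s)"
      by (rule hermitian_schur_complement[OF h])
    fix v :: "'a \<Rightarrow> complex"
    assume v: "\<exists>i\<in>S. v i \<noteq> 0"
    \<comment> \<open>This value of the coordinate \<open>s\<close> makes the square vanish, so that
      only the form of the Schur complement is left.\<close>
    let ?w = "v(s := - (\<Sum>j\<in>S. A s j * v j) / A s s)"
    have c: "(\<Sum>j\<in>S. A s j * ?w j) = (\<Sum>j\<in>S. A s j * v j)"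
      using assms by (intro sum.cong) auto
    have "\<exists>i\<in>insert s S. ?w i \<noteq> 0"
      using v assms(2) by auto
    then have "0 < qf (insert s S) A ?w"
      using pd unfolding pd_on_def by blast
    also have "\<dots> = qf S (schur_complement A s) ?w"
      using assms h pos unfolding qf_insert_hermitian[OF assms h less_imp_neq[OF pos, symmetric]] c
      by simp
    also have "\<dots> = qf S (schur_complement A s) v"
      using assms by (intro qf_cong) auto
    finally show "0 < qf S (schur_complement A s) v" .
  qed
next
  assume h: "hermitian_on (insert s S) A" and pos: "0 < A s s"
    and pd: "pd_on S (schur_complement A s)"
  show "pd_on (insert s S) A"
    unfolding pd_on_def
  proof (intro conjI allI impI)
    show "hermitian_on (insert s S) A" by (rule h)
    fix v :: "'a \<Rightarrow> complex"
    assume v: "\<exists>i\<in>insert s S. v i \<noteq> 0"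
    note eq = qf_insert_hermitian[OF assms h less_imp_neq[OF pos, symmetric], of v]
    show "0 < qf (insert s S) A v"
    proof (cases "\<exists>i\<in>S. v i \<noteq> 0")
      case True
      then have "0 < qf S (schur_complement A s) v"
        using pd by (auto simp: pd_on_def)
      moreover have "0 \<le> A s s * (cmod (v s + (\<Sum>j\<in>S. A s j * v j) / A s s))\<^sup>2"
        using pos by (intro mult_nonneg_nonneg) (auto simp: less_eq_complex_def less_complex_def)
      ultimately show ?thesis unfolding eq by (rule add_pos_nonneg)
    next
      \<comment> \<open>The Schur complement term is zero here, so strictness has to come from the
        square, which reduces to the one of \<open>v s\<close>.\<close>
      case False
      then have "(\<Sum>j\<in>S. A s j * v j) = 0" "qf S (schur_complement A s) v = 0"
        by (auto simp: qf_def intro!: sum.neutral)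
      moreover have "v s \<noteq> 0" using False v by auto
      ultimately show ?thesis
        unfolding eq using pos by (simp add: less_complex_def)
    qed
  qed
qed

section \<open>Positive definite completion\<close>

lemma pd_on_disjoint_Un:
  assumes "finite P" "finite R" "P \<inter> R = {}" "pd_on P A" "pd_on R A"
    and zero: "\<And>p r. p \<in> P \<Longrightarrow> r \<in> R \<Longrightarrow> A p r = 0 \<and> A r p = 0"
  shows "pd_on (P \<union> R) A"
  unfolding pd_on_def
proof (intro conjI allI impI)
  show "hermitian_on (P \<union> R) A"
    using assms by (auto simp: hermitian_on_def pd_on_def)
  fix v :: "'a \<Rightarrow> complex"
  assume v: "\<exists>i\<in>P \<union> R. v i \<noteq> 0"
  have eq: "qf (P \<union> R) A v = qf P A v + qf R A v"
    using assms(1-3) zero by (simp add: qf_def sum.union_disjoint sum.distrib)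
  have nonneg: "0 \<le> qf S A v" "(\<exists>i\<in>S. v i \<noteq> 0) \<Longrightarrow> 0 < qf S A v" if "pd_on S A" for S
  proof -
    show *: "(\<exists>i\<in>S. v i \<noteq> 0) \<Longrightarrow> 0 < qf S A v"
      using that by (auto simp: pd_on_def)
    show "0 \<le> qf S A v"
    proof (cases "\<exists>i\<in>S. v i \<noteq> 0")
      case True
      then show ?thesis using * by (simp add: order.strict_implies_order)
    next
      case False
      then have "qf S A v = 0" by (simp add: qf_def)
      then show ?thesis by simp
    qed
  qed
  show "0 < qf (P \<union> R) A v"
    unfolding eq using v nonneg[OF assms(4)] nonneg[OF assms(5)]
    by (auto intro: add_pos_nonneg add_nonneg_pos)
qed

text \<open>
  Induction on \<open>Q\<close>: eliminating a pivot \<open>s\<close> of \<open>Q\<close> replaces \<open>A\<close> by its Schur complement, and a completion of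
  the Schur complement is lifted back by adding \<open>A p s * A s r / A s s\<close>.
\<close>

lemma pd_completion:
  assumes "finite P" "finite Q" "finite R" "P \<inter> Q = {}" "P \<inter> R = {}" "Q \<inter> R = {}"
    and "pd_on (P \<union> Q) A" "pd_on (Q \<union> R) A"
  shows "\<exists>X. \<forall>B. (\<forall>i\<in>P \<union> Q. \<forall>j\<in>P \<union> Q. B i j = A i j) \<and>
      (\<forall>i\<in>Q \<union> R. \<forall>j\<in>Q \<union> R. B i j = A i j) \<and>
      (\<forall>p\<in>P. \<forall>r\<in>R. B p r = X p r \<and> B r p = cnj (X p r)) \<longrightarrow> pd_on (P \<union> Q \<union> R) B"
  using assms(2,4,6-8)
proof (induction Q arbitrary: A rule: finite_induct)
  case empty
  show ?case
  \<comment> \<open>Without overlap the two diagonal blocks are independent, and zero is a valid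
    off-diagonal block.\<close>
  proof (intro exI[of _ "\<lambda>_ _. 0"] allI impI; elim conjE)
    fix B :: "'a \<Rightarrow> 'a \<Rightarrow> complex"
    assume *: "\<forall>i\<in>P \<union> {}. \<forall>j\<in>P \<union> {}. B i j = A i j"
      "\<forall>i\<in>{} \<union> R. \<forall>j\<in>{} \<union> R. B i j = A i j"
      "\<forall>p\<in>P. \<forall>r\<in>R. B p r = 0 \<and> B r p = cnj 0"
    have "pd_on P B" "pd_on R B"
      using empty.prems * pd_on_cong[of P B A] pd_on_cong[of R B A] by auto
    then show "pd_on (P \<union> {} \<union> R) B"
      using assms * by (simp add: pd_on_disjoint_Un)
  qed
next
  case (insert s Q)
  let ?S = "schur_complement A s"
  have s: "s \<notin> P \<union> Q" "s \<notin> Q \<union> R" "s \<notin> P \<union> Q \<union> R" using insert by auto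
  have fin: "finite (P \<union> Q)" "finite (Q \<union> R)" "finite (P \<union> Q \<union> R)"
    using insert assms by auto
  have pd1: "pd_on (insert s (P \<union> Q)) A" and pd2: "pd_on (insert s (Q \<union> R)) A"
    using insert.prems by (simp_all add: Un_commute)
  have h: "hermitian_on (insert s (P \<union> Q)) A" "hermitian_on (insert s (Q \<union> R)) A"
    using pd1 pd2 by (auto simp: pd_on_def)
  have pos: "0 < A s s" and pd': "pd_on (P \<union> Q) ?S" "pd_on (Q \<union> R) ?S"
    using pd1 pd2 pd_on_insert_iff[OF fin(1) s(1), of A] pd_on_insert_iff[OF fin(2) s(2), of A] by auto
  have "P \<inter> Q = {}" "Q \<inter> R = {}" using insert.prems by auto
  from insert.IH[OF this pd'] obtain X where
    X: "\<And>B. (\<forall>i\<in>P \<union> Q. \<forall>j\<in>P \<union> Q. B i j = ?S i j) \<Longrightarrow>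
      (\<forall>i\<in>Q \<union> R. \<forall>j\<in>Q \<union> R. B i j = ?S i j) \<Longrightarrow>
      (\<forall>p\<in>P. \<forall>r\<in>R. B p r = X p r \<and> B r p = cnj (X p r)) \<Longrightarrow> pd_on (P \<union> Q \<union> R) B"
    by blast
  show ?case
  proof (intro exI[of _ "\<lambda>p r. X p r + A p s * A s r / A s s"] allI impI; elim conjE)
    fix B :: "'a \<Rightarrow> 'a \<Rightarrow> complex"
    assume B1: "\<forall>i\<in>P \<union> insert s Q. \<forall>j\<in>P \<union> insert s Q. B i j = A i j"
      and B2: "\<forall>i\<in>insert s Q \<union> R. \<forall>j\<in>insert s Q \<union> R. B i j = A i j"
      and B3: "\<forall>p\<in>P. \<forall>r\<in>R. B p r = X p r + A p s * A s r / A s s \<and>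
        B r p = cnj (X p r + A p s * A s r / A s s)"
    have "pd_on (P \<union> Q \<union> R) (schur_complement B s)"
      using B1 B2 B3 h
      by (intro X) (auto simp: schur_complement_def hermitian_on_def)
    moreover have "hermitian_on (insert s (P \<union> Q \<union> R)) B"
      using B1 B2 B3 h by (auto simp: hermitian_on_def)
    moreover have "B s s = A s s" using B1 by auto
    ultimately have "pd_on (insert s (P \<union> Q \<union> R)) B"
      using pos pd_on_insert_iff[OF fin(3) s(3), of B] by auto
    then show "pd_on (P \<union> insert s Q \<union> R) B" by simp
  qed
qed

text \<open>Renaming indices along an injection; this is what moves a block Toeplitz matrix by one
  position.\<close>

lemma pd_on_image:
  assumes "inj_on f J" "pd_on J (\<lambda>i j. A (f i) (f j))"
  shows "pd_on (f ` J) A"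
proof -
  have "qf (f ` J) A v = qf J (\<lambda>i j. A (f i) (f j)) (v \<circ> f)" for v
    unfolding qf_def by (simp add: sum.reindex[OF assms(1)])
  then show ?thesis
    using assms(2) by (auto simp: pd_on_def hermitian_on_def)
qed

text \<open>Induction on the pivots of \<open>C\<close>, which is the rank one matrix C_is C_sj /
  C_ss plus its Schur complement. The rank one part contributes the form of \<open>A\<close> at the
  row \<open>C s\<close>, divided by a positive pivot; the rest is a smaller instance.\<close>

lemma schur_product_sum_nonneg:
  assumes "finite I" "psd_on I A" "pd_on I C"
  shows "0 \<le> (\<Sum>i\<in>I. \<Sum>j\<in>I. A i j * C i j)"
  using assms
proof (induction I arbitrary: C rule: finite_induct)
  case empty
  then show ?case by simp
next
  case (insert s S)
  let ?D = "schur_complement C s"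
  have h: "hermitian_on (insert s S) C" and pos: "0 < C s s" and pd: "pd_on S ?D"
    using insert.prems pd_on_insert_iff[OF insert.hyps] by auto
  have psd: "psd_on S A"
    unfolding psd_on_def
  proof
    fix v
    have "qf (insert s S) A (v(s := 0)) = qf S A (v(s := 0))"
      using insert.hyps by (simp add: qf_insert)
    also have "\<dots> = qf S A v"
      using insert.hyps by (intro qf_cong) auto
    finally show "0 \<le> qf S A v"
      using insert.prems by (metis psd_on_def)
  qed
  \<comment> \<open>The Schur complement has zero row and column at \<open>s\<close>, so its part of
    the sum lives on \<open>S\<close>.\<close>
  have D0: "?D i s = 0" "?D s i = 0" for i
    using pos by (auto simp: schur_complement_def)
  have "(\<Sum>i\<in>insert s S. \<Sum>j\<in>insert s S. A i j * C i j)
    = (\<Sum>i\<in>insert s S. \<Sum>j\<in>insert s S. A i j * C s j * cnj (C s i) / C s s + A i j * ?D i j)"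
  proof (intro sum.cong refl)
    fix i j assume "i \<in> insert s S" "j \<in> insert s S"
    then have "cnj (C s i) = C i s" using h by (auto simp: hermitian_on_def)
    then show "A i j * C i j = A i j * C s j * cnj (C s i) / C s s + A i j * ?D i j"
      by (simp add: schur_complement_def algebra_simps)
  qed
  also have "\<dots> = qf (insert s S) A (C s) / C s s + (\<Sum>i\<in>S. \<Sum>j\<in>S. A i j * ?D i j)"
    using insert.hyps D0
    by (simp only: sum.distrib qf_def sum_divide_distrib) simp
  also have "\<dots> \<ge> 0"
  proof (rule add_nonneg_nonneg)
    have "0 \<le> qf (insert s S) A (C s)" using insert.prems by (simp add: psd_on_def)
    then show "0 \<le> qf (insert s S) A (C s) / C s s"
      using pos by (auto simp: less_eq_complex_def less_complex_def complex_is_Real_iff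
          Re_divide Im_divide)
    show "0 \<le> (\<Sum>i\<in>S. \<Sum>j\<in>S. A i j * ?D i j)"
      by (rule insert.IH[OF psd pd])
  qed
  finally show ?case .
qed

section \<open>From semidefinite to definite matrices\<close>

lemma qf_support:
  assumes "finite I" "J \<subseteq> I" "\<And>i. i \<in> I - J \<Longrightarrow> v i = 0"
  shows "qf I A v = qf J A v"
proof -
  have "(\<Sum>j\<in>I. A i j * v j * cnj (v i)) = (\<Sum>j\<in>J. A i j * v j * cnj (v i))" for i
    using assms by (intro sum.mono_neutral_right) auto
  moreover have "(\<Sum>i\<in>I. \<Sum>j\<in>J. A i j * v j * cnj (v i)) = (\<Sum>i\<in>J. \<Sum>j\<in>J. A i j * v j * cnj (v i))"
    using assms by (intro sum.mono_neutral_right) auto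
  ultimately show ?thesis by (simp add: qf_def)
qed

text \<open>Polarisation: vectors supported at one point make the diagonal real, and vectors
  supported at two points relate A_ij to A_ji.\<close>

lemma psd_on_hermitian:
  assumes "finite I" "psd_on I A"
  shows "hermitian_on I A"
  unfolding hermitian_on_def
proof (intro ballI)
  fix i j assume ij: "i \<in> I" "j \<in> I"
  have *: "Im (qf I A v) = 0" for v
    using assms by (simp add: psd_on_def less_eq_complex_def)
  have diag: "Im (A k k) = 0" if "k \<in> I" for k
  proof -
    have "qf I A (\<lambda>x. if x = k then 1 else 0) = qf {k} A (\<lambda>x. if x = k then 1 else 0)"
      using that assms by (intro qf_support) auto
    then show ?thesis using *[of "\<lambda>x. if x = k then 1 else 0"] by (simp add: qf_def)
  qed
  show "cnj (A i j) = A j i"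
  proof (cases "i = j")
    case True
    then show ?thesis using diag[OF ij(1)] by (simp add: complex_eq_iff)
  next
    case False
    have "Im (A i j * c + A j i * cnj c) = 0" for c
    proof -
      let ?v = "\<lambda>x. if x = i then 1 else if x = j then c else 0"
      have "qf I A ?v = qf {i, j} A ?v"
        using ij assms by (intro qf_support) auto
      also have "\<dots> = A i i + (A i j * c + A j i * cnj c) + A j j * (c * cnj c)"
        using False by (simp add: qf_def algebra_simps)
      finally show ?thesis using *[of ?v] diag[OF ij(1)] diag[OF ij(2)] by simp
    qed
    \<comment> \<open>The value 1 makes the imaginary parts opposite, the value \<open>\<i>\<close>
      makes the real parts equal.\<close>
    from this[of 1] this[of \<i>] show ?thesis by (simp add: complex_eq_iff)
  qed
qed

lemma pd_on_add_identity:
  assumes "finite I" "psd_on I A"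
  shows "pd_on I (\<lambda>i j. A i j + (if i = j then 1 else 0))"
  unfolding pd_on_def
proof (intro conjI allI impI)
  show "hermitian_on I (\<lambda>i j. A i j + (if i = j then 1 else 0))"
    using psd_on_hermitian[OF assms] by (auto simp: hermitian_on_def)
  fix v :: "'a \<Rightarrow> complex"
  assume v: "\<exists>i\<in>I. v i \<noteq> 0"
  have "qf I (\<lambda>i j. A i j + (if i = j then 1 else 0)) v
    = qf I A v + (\<Sum>i\<in>I. of_real ((cmod (v i))\<^sup>2))"
    unfolding qf_def complex_norm_square using assms(1)
    by (simp add: sum.distrib distrib_right if_distrib [where f = "\<lambda>x. x * _"] cong: if_cong)
  moreover have "0 < (\<Sum>i\<in>I. (cmod (v i))\<^sup>2)"
    using v assms(1) by (auto intro!: sum_pos2)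
  then have "0 < (\<Sum>i\<in>I. complex_of_real ((cmod (v i))\<^sup>2))"
    by (simp add: less_complex_def)
  ultimately show "0 < qf I (\<lambda>i j. A i j + (if i = j then 1 else 0)) v"
    using assms(2) by (simp add: psd_on_def add_nonneg_pos)
qed

section \<open>Block Toeplitz matrices and Fejer sums\<close>

text \<open>The block index comes first and the Toeplitz position second, matching
  \<open>r div n\<close> and \<open>r mod n\<close> in \<open>flatten_blocks\<close>.\<close>

definition toeplitz_blocks :: "('i \<Rightarrow> 'i \<Rightarrow> int \<Rightarrow> complex) \<Rightarrow> 'i \<times> nat \<Rightarrow> 'i \<times> nat \<Rightarrow> complex" where
  "toeplitz_blocks t = (\<lambda>(i, k) (j, l). t i j (int k - int l))"

lemma toeplitz_blocks_simp [simp]: "toeplitz_blocks t (i, k) (j, l) = t i j (int k - int l)"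
  by (simp add: toeplitz_blocks_def)

text \<open>The positions 0 to N are covered by 0 to N - 1 and 1 to N. Entries depend only on
  differences of positions, so the second range carries a translate of the given matrix and is
  positive definite too. Only the two corner blocks are free; each is the sole block on its
  diagonal, so every completion is again Toeplitz.\<close>

lemma toeplitz_extend_step:
  assumes "finite I" "N \<ge> 1" "pd_on (I \<times> {..<N}) (toeplitz_blocks t)"
  shows "\<exists>t'. (\<forall>i j k. \<bar>k\<bar> < int N \<longrightarrow> t' i j k = t i j k) \<and>
    pd_on (I \<times> {..<Suc N}) (toeplitz_blocks t')"
proof -
  let ?P = "I \<times> {0::nat}" and ?Q = "I \<times> {1..<N}" and ?R = "I \<times> {N}"
  have PQ: "?P \<union> ?Q = I \<times> {..<N}" using assms(2) by auto
  have QR: "?Q \<union> ?R = (\<lambda>(i, k). (i, Suc k)) ` (I \<times> {..<N})"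
  proof -
    have "{1..<N} \<union> {N} = Suc ` {..<N}"
      using assms(2) by (auto simp: image_iff) (metis Suc_pred lessThan_iff Suc_less_eq Suc_le_eq less_Suc_eq)+
    then have "?Q \<union> ?R = I \<times> Suc ` {..<N}" by blast
    then show ?thesis by force
  qed
  have "pd_on (?P \<union> ?Q) (toeplitz_blocks t)"
    unfolding PQ by (rule assms)
  moreover have "pd_on (?Q \<union> ?R) (toeplitz_blocks t)"
    unfolding QR
  proof (rule pd_on_image)
    show "inj_on (\<lambda>(i, k). (i, Suc k)) (I \<times> {..<N})" by (auto simp: inj_on_def)
    show "pd_on (I \<times> {..<N}) (\<lambda>p q. toeplitz_blocks t (case p of (i, k) \<Rightarrow> (i, Suc k))
        (case q of (i, k) \<Rightarrow> (i, Suc k)))"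
      using assms(3) by (rule iffD1[OF pd_on_cong, rotated]) auto
  qed
  ultimately have "\<exists>X. \<forall>B. (\<forall>i\<in>?P \<union> ?Q. \<forall>j\<in>?P \<union> ?Q. B i j = toeplitz_blocks t i j) \<and>
      (\<forall>i\<in>?Q \<union> ?R. \<forall>j\<in>?Q \<union> ?R. B i j = toeplitz_blocks t i j) \<and>
      (\<forall>p\<in>?P. \<forall>r\<in>?R. B p r = X p r \<and> B r p = cnj (X p r)) \<longrightarrow> pd_on (?P \<union> ?Q \<union> ?R) B"
    using assms(1,2) by (intro pd_completion) auto
  then obtain X where X: "\<And>B. (\<forall>i\<in>?P \<union> ?Q. \<forall>j\<in>?P \<union> ?Q. B i j = toeplitz_blocks t i j) \<Longrightarrow>
      (\<forall>i\<in>?Q \<union> ?R. \<forall>j\<in>?Q \<union> ?R. B i j = toeplitz_blocks t i j) \<Longrightarrow>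
      (\<forall>p\<in>?P. \<forall>r\<in>?R. B p r = X p r \<and> B r p = cnj (X p r)) \<Longrightarrow> pd_on (?P \<union> ?Q \<union> ?R) B"
    by blast
  \<comment> \<open>Row position 0 and column position N have difference -N, which places
    \<open>X\<close> there; the opposite corner is its adjoint, hence the exchange of
    \<open>i\<close> and \<open>j\<close>. The two cases are distinct because
    \<open>N \<ge> 1\<close>.\<close>
  define t' where "t' = (\<lambda>i j k. if k = - int N then X (i, 0) (j, N)
    else if k = int N then cnj (X (j, 0) (i, N)) else t i j k)"
  have "pd_on (?P \<union> ?Q \<union> ?R) (toeplitz_blocks t')"
    using assms(2) by (intro X) (auto simp: t'_def)
  moreover have "?P \<union> ?Q \<union> ?R = I \<times> {..<Suc N}" using assms(2) by auto
  ultimately show ?thesis by (intro exI[of _ t']) (auto simp: t'_def)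
qed

lemma toeplitz_extend:
  assumes "finite I" "n \<ge> 1" "pd_on (I \<times> {..<n}) (toeplitz_blocks t)" "n \<le> N"
  shows "\<exists>t'. (\<forall>i j k. \<bar>k\<bar> < int n \<longrightarrow> t' i j k = t i j k) \<and>
    pd_on (I \<times> {..<N}) (toeplitz_blocks t')"
  using assms(4)
proof (induction N rule: dec_induct)
  case base
  then show ?case using assms(3) by blast
next
  case (step N)
  then obtain t' where t': "\<forall>i j k. \<bar>k\<bar> < int n \<longrightarrow> t' i j k = t i j k"
    "pd_on (I \<times> {..<N}) (toeplitz_blocks t')" by blast
  moreover obtain t'' where "\<forall>i j k. \<bar>k\<bar> < int N \<longrightarrow> t'' i j k = t' i j k"
    "pd_on (I \<times> {..<Suc N}) (toeplitz_blocks t'')"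
    using toeplitz_extend_step[OF assms(1) _ t'(2)] assms(2) step by auto
  ultimately show ?case using step by (intro exI[of _ t'']) auto
qed

section \<open>Fejer sums on the unit circle\<close>

lemma powi_diff_unit:
  assumes "cmod z = 1"
  shows "z powi (int k - int l) = z ^ k * cnj z ^ l"
proof -
  have "z \<noteq> 0" using assms by auto
  moreover have "inverse z = cnj z"
    using assms by (simp add: inverse_eq_divide divide_conv_cnj)
  ultimately show ?thesis
    by (simp add: power_int_diff divide_inverse flip: power_inverse)
qed

text \<open>A difference d occurs N - |d| times among the pairs, so this is N times the Fejer mean
  of the series with terms t_d z^d.\<close>

definition fejer_sum :: "nat \<Rightarrow> (int \<Rightarrow> complex) \<Rightarrow> complex \<Rightarrow> complex" where
  "fejer_sum N t z = (\<Sum>k<N. \<Sum>l<N. t (int k - int l) * z powi (int k - int l))"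

lemma fejer_sum_pd:
  assumes "finite I" "N \<ge> 1" "pd_on (I \<times> {..<N}) (toeplitz_blocks t)" "cmod z = 1"
  shows "pd_on I (\<lambda>i j. fejer_sum N (t i j) z)"
  unfolding pd_on_def
proof (intro conjI allI impI)
  have h: "cnj (t i j (int k - int l)) = t j i (int l - int k)"
    if "i \<in> I" "j \<in> I" "k < N" "l < N" for i j k l
  proof -
    have "hermitian_on (I \<times> {..<N}) (toeplitz_blocks t)"
      using assms(3) by (simp add: pd_on_def)
    then have "cnj (toeplitz_blocks t (i, k) (j, l)) = toeplitz_blocks t (j, l) (i, k)"
      using that unfolding hermitian_on_def by blast
    then show ?thesis by simp
  qed
  show "hermitian_on I (\<lambda>i j. fejer_sum N (t i j) z)"
    unfolding hermitian_on_def
  proof (intro ballI)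
    fix i j assume ij: "i \<in> I" "j \<in> I"
    have "cnj (fejer_sum N (t i j) z)
      = (\<Sum>k<N. \<Sum>l<N. t j i (int l - int k) * z powi (int l - int k))"
      unfolding fejer_sum_def cnj_sum using ij assms(4)
      by (intro sum.cong refl) (simp add: h powi_diff_unit)
    also have "\<dots> = fejer_sum N (t j i) z"
      unfolding fejer_sum_def by (rule sum.swap)
    finally show "cnj (fejer_sum N (t i j) z) = fejer_sum N (t j i) z" .
  qed
  fix v :: "'a \<Rightarrow> complex"
  assume v: "\<exists>i\<in>I. v i \<noteq> 0"
  \<comment> \<open>On the circle z^(k-l) splits into a factor for each index; absorbing both into
    the vector turns the form of the Fejer sums at \<open>v\<close> into the block Toeplitz form at
    \<open>?w\<close>.\<close>
  let ?w = "\<lambda>(i, k). cnj z ^ k * v i"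
  have "(\<Sum>j\<in>I. fejer_sum N (t i j) z * v j * cnj (v i))
    = (\<Sum>k<N. \<Sum>j\<in>I. \<Sum>l<N. t i j (int k - int l) * ?w (j, l) * cnj (?w (i, k)))" for i
  proof -
    have "(\<Sum>j\<in>I. fejer_sum N (t i j) z * v j * cnj (v i))
      = (\<Sum>j\<in>I. \<Sum>k<N. \<Sum>l<N. t i j (int k - int l) * ?w (j, l) * cnj (?w (i, k)))"
      unfolding fejer_sum_def sum_distrib_right
      by (intro sum.cong refl) (simp add: powi_diff_unit[OF assms(4)])
    also have "\<dots> = (\<Sum>k<N. \<Sum>j\<in>I. \<Sum>l<N. t i j (int k - int l) * ?w (j, l) * cnj (?w (i, k)))"
      by (rule sum.swap)
    finally show ?thesis .
  qed
  then have "qf I (\<lambda>i j. fejer_sum N (t i j) z) v = qf (I \<times> {..<N}) (toeplitz_blocks t) ?w"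
    unfolding qf_def by (simp add: sum.cartesian_product' split_def)
  moreover have "0 < qf (I \<times> {..<N}) (toeplitz_blocks t) ?w"
  proof -
    \<comment> \<open>At position 0, available since \<open>N \<ge> 1\<close>, the vector
      \<open>?w\<close> agrees with \<open>v\<close>.\<close>
    have "\<exists>p\<in>I \<times> {..<N}. ?w p \<noteq> 0"
      using v assms(2,4) by (auto intro!: bexI[of _ "(_, 0)"])
    then show ?thesis using assms(3) unfolding pd_on_def by blast
  qed
  ultimately show "0 < qf I (\<lambda>i j. fejer_sum N (t i j) z) v" by simp
qed

section \<open>Averaging over roots of unity\<close>

lemma sum_roots_of_unity_powi:
  assumes "\<bar>p\<bar> < int M"
  shows "(\<Sum>r<M. cis (2 * pi * real r / real M) powi p) = (if p = 0 then of_nat M else 0)"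
proof (cases "p = 0")
  case False
  let ?w = "cis (2 * pi * real_of_int p / real M)"
  have M: "M > 0" using assms by auto
  \<comment> \<open>Equality would make \<open>M\<close> divide \<open>p\<close>, against 0 < |p| <
    M. The geometric sum then vanishes because \<open>?w ^ M = 1\<close>.\<close>
  have "?w \<noteq> 1"
  proof
    assume "?w = 1"
    then have "cos (2 * pi * real_of_int p / real M) = 1" by (simp add: complex_eq_iff)
    then obtain q :: int where "2 * pi * real_of_int p / real M = real_of_int q * 2 * pi"
      unfolding cos_one_2pi_int by blast
    then have "real_of_int p = real_of_int (q * int M)" using M by (simp add: field_simps)
    then have "p = q * int M" by (simp only: of_int_eq_iff)
    then show False
      using assms False dvd_imp_le_int[of p "int M"] by auto
  qed
  have "cis (2 * pi * real r / real M) powi p = ?w ^ r" for r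
    by (simp add: cis_power_int Complex.DeMoivre mult_ac)
  then have "(\<Sum>r<M. cis (2 * pi * real r / real M) powi p) = (\<Sum>r<M. ?w ^ r)" by simp
  also have "\<dots> = (?w ^ M - 1) / (?w - 1)"
    by (rule geometric_sum[OF \<open>?w \<noteq> 1\<close>])
  also have "?w ^ M = 1"
    using M by (simp add: Complex.DeMoivre cis_multiple_2pi)
  finally show ?thesis using False by simp
qed simp

text \<open>This count is the source of the Fejer weights N - |\<kappa>|.\<close>

lemma count_differences:
  assumes "\<bar>\<kappa>\<bar> \<le> int N"
  shows "(\<Sum>k<N. \<Sum>l<N. if \<kappa> + (int k - int l) = 0 then 1 else 0) = (of_int (int N - \<bar>\<kappa>\<bar>) :: complex)"
proof -
  have "(\<Sum>l<N. if \<kappa> + (int k - int l) = 0 then 1 else 0)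
    = (if 0 \<le> \<kappa> + int k \<and> \<kappa> + int k < int N then 1 else 0 :: complex)" for k
  proof -
    \<comment> \<open>The guard is there because \<open>nat\<close> sends negative integers to 0,
      which would otherwise be counted as a hit.\<close>
    have "(\<Sum>l<N. if \<kappa> + (int k - int l) = 0 then 1 else 0)
      = (\<Sum>l<N. if l = nat (\<kappa> + int k) then (if 0 \<le> \<kappa> + int k then 1 else 0) else 0 :: complex)"
      by (intro sum.cong refl) auto
    also have "\<dots> = (if 0 \<le> \<kappa> + int k \<and> \<kappa> + int k < int N then 1 else 0)"
      by (subst sum.delta) auto
    finally show ?thesis .
  qed
  then have "(\<Sum>k<N. \<Sum>l<N. if \<kappa> + (int k - int l) = 0 then 1 else 0)
    = (\<Sum>k<N. if 0 \<le> \<kappa> + int k \<and> \<kappa> + int k < int N then 1 else 0 :: complex)" by simp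
  also have "\<dots> = of_nat (card {k \<in> {..<N}. 0 \<le> \<kappa> + int k \<and> \<kappa> + int k < int N})"
    by (simp add: sum.If_cases Int_def)
  \<comment> \<open>At least one of the two truncated shifts is 0, so a single interval covers both
    signs of \<kappa>.\<close>
  also have "{k \<in> {..<N}. 0 \<le> \<kappa> + int k \<and> \<kappa> + int k < int N}
    = {nat (- \<kappa>)..<N - nat \<kappa>}" by auto
  also have "of_nat (card \<dots>) = (of_int (int N - \<bar>\<kappa>\<bar>) :: complex)"
  proof -
    have "int (card {nat (- \<kappa>)..<N - nat \<kappa>}) = int N - \<bar>\<kappa>\<bar>" using assms by auto
    then show ?thesis by (metis of_int_of_nat_eq)
  qed
  finally show ?thesis .
qed

text \<open>A discrete form of integration over the circle. The exponents \<kappa> + k - l have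
  modulus at most 2N - 2, so \<open>2 * N\<close> roots of unity isolate the constant term
  exactly.\<close>

lemma fejer_average:
  assumes "n \<le> N"
  shows "(\<Sum>r<2 * N. symbol n a (cis (2 * pi * real r / real (2 * N)))
      * fejer_sum N t (cis (2 * pi * real r / real (2 * N))))
    = of_nat (2 * N) * (\<Sum>\<kappa>\<in>{- int n<..<int n}. of_int (int N - \<bar>\<kappa>\<bar>) * (a \<kappa> * t (- \<kappa>)))"
proof -
  let ?z = "\<lambda>r. cis (2 * pi * real r / real (2 * N))"
  let ?K = "{- int n<..<int n}"
  have "symbol n a (?z r) * fejer_sum N t (?z r) = (\<Sum>\<kappa>\<in>?K. \<Sum>k<N. \<Sum>l<N.
      a \<kappa> * t (int k - int l) * ?z r powi (\<kappa> + (int k - int l)))" for r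
    unfolding symbol_def fejer_sum_def sum_distrib_right unfolding sum_distrib_left
    by (intro sum.cong refl) (simp add: power_int_add)
  then have "(\<Sum>r<2 * N. symbol n a (?z r) * fejer_sum N t (?z r))
    = (\<Sum>r<2 * N. \<Sum>\<kappa>\<in>?K. \<Sum>k<N. \<Sum>l<N.
      a \<kappa> * t (int k - int l) * ?z r powi (\<kappa> + (int k - int l)))" by simp
  also have "\<dots> = (\<Sum>\<kappa>\<in>?K. \<Sum>k<N. \<Sum>l<N. \<Sum>r<2 * N.
      a \<kappa> * t (int k - int l) * ?z r powi (\<kappa> + (int k - int l)))"
    by (subst sum.swap, rule sum.cong[OF refl])+ simp
  also have "\<dots> = (\<Sum>\<kappa>\<in>?K. \<Sum>k<N. \<Sum>l<N.
      of_nat (2 * N) * (a \<kappa> * t (- \<kappa>)) * (if \<kappa> + (int k - int l) = 0 then 1 else 0))"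
  proof (intro sum.cong refl)
    fix \<kappa> k l assume *: "\<kappa> \<in> ?K" "k \<in> {..<N}" "l \<in> {..<N}"
    have "(\<Sum>r<2 * N. ?z r powi (\<kappa> + (int k - int l)))
      = (if \<kappa> + (int k - int l) = 0 then of_nat (2 * N) else 0)"
      using * assms by (intro sum_roots_of_unity_powi) auto
    moreover have "t (int k - int l) = t (- \<kappa>)" if "\<kappa> + (int k - int l) = 0"
      using that by (intro arg_cong[where f = t]) simp
    ultimately show "(\<Sum>r<2 * N. a \<kappa> * t (int k - int l) * ?z r powi (\<kappa> + (int k - int l)))
      = of_nat (2 * N) * (a \<kappa> * t (- \<kappa>)) * (if \<kappa> + (int k - int l) = 0 then 1 else 0)"
      unfolding sum_distrib_left [symmetric]
      by (cases "\<kappa> + (int k - int l) = 0") (simp_all only: if_True if_False simp_thms mult_ac mult_1_right mult_1_left mult_zero_right mult_zero_left)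
  qed
  also have "\<dots> = (\<Sum>\<kappa>\<in>?K. of_nat (2 * N) * (a \<kappa> * t (- \<kappa>)) * of_int (int N - \<bar>\<kappa>\<bar>))"
    using assms unfolding sum_distrib_left [symmetric]
    by (intro sum.cong refl arg_cong2[where f = "(*)"] count_differences) auto
  finally show ?thesis
    by (simp only: sum_distrib_left mult_ac)
qed

text \<open>Divide by N and let N grow. The same limit serves for the Fejer weights and for removing
  the perturbation by the identity.\<close>

lemma complex_nonneg_of_linear_growth:
  fixes P Q :: complex
  assumes "\<And>N. N \<ge> n \<Longrightarrow> 0 \<le> of_nat N * P + Q"
  shows "0 \<le> P"
proof -
  have re: "0 \<le> real N * Re P + Re Q" and im: "real N * Im P + Im Q = 0" if "N \<ge> n" for N
    using assms[OF that] by (simp_all add: less_eq_complex_def)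
  have "Im P = 0"
    using im[of n] im[of "Suc n"] by (simp add: algebra_simps)
  moreover have "0 \<le> Re P"
  proof (rule ccontr)
    assume "\<not> 0 \<le> Re P"
    then have neg: "Re P < 0" by simp
    obtain N :: nat where "Re Q / - Re P < real N" using reals_Archimedean2 by blast
    then have "Re Q < real N * - Re P" using neg by (simp add: field_simps)
    also have "\<dots> \<le> real (max n N) * - Re P"
      using neg by (intro mult_right_mono) auto
    finally show False using re[of "max n N"] by simp
  qed
  ultimately show ?thesis by (simp add: less_eq_complex_def)
qed

section \<open>Positivity of the pairing\<close>

definition pairing :: "nat \<Rightarrow> 'i set \<Rightarrow> ('i \<Rightarrow> 'i \<Rightarrow> int \<Rightarrow> complex) \<Rightarrow> ('i \<Rightarrow> 'i \<Rightarrow> int \<Rightarrow> complex) \<Rightarrow> complex" where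
  "pairing n I a t = (\<Sum>i\<in>I. \<Sum>j\<in>I. \<Sum>\<kappa>\<in>{- int n<..<int n}. a i j \<kappa> * t i j (- \<kappa>))"

text \<open>Extend to size N, apply the Schur product pointwise at the roots of unity and average.
  The outcome is linear in N with leading coefficient the pairing.\<close>

lemma pairing_nonneg_of_pd:
  assumes "finite I" "n \<ge> 1" "pd_on (I \<times> {..<n}) (toeplitz_blocks t)"
    and "\<And>z. cmod z = 1 \<Longrightarrow> psd_on I (\<lambda>i j. symbol n (a i j) z)"
  shows "0 \<le> pairing n I a t"
proof (rule complex_nonneg_of_linear_growth)
  fix N assume N: "N \<ge> n"
  let ?K = "{- int n<..<int n}"
  let ?z = "\<lambda>r. cis (2 * pi * real r / real (2 * N))"
  obtain t' where t': "\<And>i j k. \<bar>k\<bar> < int n \<Longrightarrow> t' i j k = t i j k"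
    "pd_on (I \<times> {..<N}) (toeplitz_blocks t')"
    using toeplitz_extend[OF assms(1-3) N] by blast
  let ?W = "\<Sum>i\<in>I. \<Sum>j\<in>I. \<Sum>\<kappa>\<in>?K. of_int (int N - \<bar>\<kappa>\<bar>) * (a i j \<kappa> * t' i j (- \<kappa>))"
  have "0 \<le> (\<Sum>r<2 * N. \<Sum>i\<in>I. \<Sum>j\<in>I. symbol n (a i j) (?z r) * fejer_sum N (t' i j) (?z r))"
    using assms N t'(2)
    by (intro sum_nonneg schur_product_sum_nonneg fejer_sum_pd) auto
  also have "\<dots> = (\<Sum>i\<in>I. \<Sum>j\<in>I. \<Sum>r<2 * N. symbol n (a i j) (?z r) * fejer_sum N (t' i j) (?z r))"
    by (subst sum.swap, rule sum.cong[OF refl])+ simp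
  also have "\<dots> = of_nat (2 * N) * ?W"
    unfolding fejer_average[OF N] sum_distrib_left by simp
  finally have W: "0 \<le> ?W"
    using assms(2) N by (simp add: less_eq_complex_def zero_le_mult_iff)
  \<comment> \<open>Only coefficients with index of modulus below n enter, and there the extension
    agrees with \<open>t\<close>; the dependence of \<open>t'\<close> on N disappears.\<close>
  have "?W = (\<Sum>i\<in>I. \<Sum>j\<in>I. \<Sum>\<kappa>\<in>?K. of_int (int N - \<bar>\<kappa>\<bar>) * (a i j \<kappa> * t i j (- \<kappa>)))"
    by (intro sum.cong refl) (auto simp: t'(1))
  also have "\<dots> = of_nat N * pairing n I a t
    + - (\<Sum>i\<in>I. \<Sum>j\<in>I. \<Sum>\<kappa>\<in>?K. of_int \<bar>\<kappa>\<bar> * (a i j \<kappa> * t i j (- \<kappa>)))"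
    unfolding pairing_def
    by (simp add: sum_distrib_left left_diff_distrib sum_subtractf)
  finally show "0 \<le> of_nat N * pairing n I a t
    + - (\<Sum>i\<in>I. \<Sum>j\<in>I. \<Sum>\<kappa>\<in>?K. of_int \<bar>\<kappa>\<bar> * (a i j \<kappa> * t i j (- \<kappa>)))"
    using W by simp
qed

text \<open>Scaling \<open>t\<close> by N and adding the identity replaces a perturbation by a small
  multiple of the identity, so that the linear growth argument applies once more.\<close>

lemma pairing_nonneg:
  assumes "finite I" "n \<ge> 1" "psd_on (I \<times> {..<n}) (toeplitz_blocks t)"
    and "\<And>z. cmod z = 1 \<Longrightarrow> psd_on I (\<lambda>i j. symbol n (a i j) z)"
  shows "0 \<le> pairing n I a t"
proof (rule complex_nonneg_of_linear_growth)
  fix N :: nat assume "N \<ge> 0"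
  \<comment> \<open>The identity as a block Toeplitz matrix: ones on the main diagonal of the
    diagonal blocks.\<close>
  let ?d = "\<lambda>i j k. if i = j \<and> k = 0 then 1 else 0 :: complex"
  let ?t = "\<lambda>i j k. of_nat N * t i j k + ?d i j k"
  have "qf (I \<times> {..<n}) (\<lambda>p q. of_nat N * toeplitz_blocks t p q) v
    = of_nat N * qf (I \<times> {..<n}) (toeplitz_blocks t) v" for v
    unfolding qf_def sum_distrib_left by (simp add: mult_ac)
  then have "psd_on (I \<times> {..<n}) (\<lambda>p q. of_nat N * toeplitz_blocks t p q)"
    using assms(3) by (simp add: psd_on_def less_eq_complex_def)
  then have "pd_on (I \<times> {..<n}) (\<lambda>p q. of_nat N * toeplitz_blocks t p q + (if p = q then 1 else 0))"
    using assms(1) by (intro pd_on_add_identity) auto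
  also have "(\<lambda>p q. of_nat N * toeplitz_blocks t p q + (if p = q then 1 else 0)) = toeplitz_blocks ?t"
    by (auto simp: fun_eq_iff)
  finally have "0 \<le> pairing n I a ?t"
    by (rule pairing_nonneg_of_pd[OF assms(1,2) _ assms(4)])
  also have "\<dots> = of_nat N * pairing n I a t + pairing n I a ?d"
    unfolding pairing_def sum_distrib_left
    by (simp only: sum.distrib [symmetric]) (intro sum.cong refl, simp add: algebra_simps)
  finally show "0 \<le> of_nat N * pairing n I a t + pairing n I a ?d" .
qed

section \<open>The duality\<close>

lemma psd_on_reindex:
  assumes "bij_betw f J I"
  shows "psd_on J (\<lambda>r s. A (f r) (f s)) \<longleftrightarrow> psd_on I A"
proof -
  have inj: "inj_on f J" and I: "I = f ` J" using assms by (auto simp: bij_betw_def)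
  have eq: "qf I A v = qf J (\<lambda>r s. A (f r) (f s)) (v \<circ> f)" for v
    unfolding qf_def I by (simp add: sum.reindex[OF inj])
  have "qf J (\<lambda>r s. A (f r) (f s)) v = qf I A (v \<circ> inv_into J f)" for v
    unfolding eq using inj by (intro qf_cong) auto
  then show ?thesis unfolding psd_on_def using eq by metis
qed

lemma psd_iff_psd_on:
  assumes "A \<in> carrier_mat d d"
  shows "psd A \<longleftrightarrow> psd_on {..<d} (\<lambda>i j. A $$ (i, j))"
proof -
  have eq: "(A *\<^sub>v v) \<bullet>c v = qf {..<d} (\<lambda>i j. A $$ (i, j)) (\<lambda>i. v $ i)" if "v \<in> carrier_vec d" for v
    using assms that unfolding qf_def
    by (simp add: scalar_prod_def sum_distrib_right atLeast0LessThan)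
  have "qf {..<d} (\<lambda>i j. A $$ (i, j)) v = qf {..<d} (\<lambda>i j. A $$ (i, j)) (\<lambda>i. vec d v $ i)" for v
    by (intro qf_cong) auto
  then show ?thesis
    unfolding psd_def psd_on_def using assms eq
    by (auto simp: square_mat.simps) (metis eq vec_carrier)
qed

lemma bij_betw_div_mod:
  assumes "n \<ge> (1::nat)"
  shows "bij_betw (\<lambda>r. (r div n, r mod n)) {..<m * n} ({..<m} \<times> {..<n})"
proof (rule bij_betw_byWitness[where f' = "\<lambda>(i, k). i * n + k"])
  show "(\<lambda>(i, k). i * n + k) ` ({..<m} \<times> {..<n}) \<subseteq> {..<m * n}"
  proof clarsimp
    fix i k assume "i < m" "k < n"
    then have "i * n + k < Suc i * n" by simp
    also have "\<dots> \<le> m * n" using \<open>i < m\<close> by (intro mult_right_mono) auto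
    finally show "i * n + k < m * n" .
  qed
qed (use assms in \<open>auto simp: less_mult_imp_div_less\<close>)

lemma psd_flatten_blocks_iff:
  assumes "n \<ge> 1" and X: "\<And>i j. i < m \<Longrightarrow> j < m \<Longrightarrow> X $$ (i, j) = toeplitz_mat n (t i j)"
  shows "psd (flatten_blocks m n X) \<longleftrightarrow> psd_on ({..<m} \<times> {..<n}) (toeplitz_blocks t)"
proof -
  let ?f = "\<lambda>r. (r div n, r mod n)"
  have "psd (flatten_blocks m n X)
    \<longleftrightarrow> psd_on {..<m * n} (\<lambda>r s. flatten_blocks m n X $$ (r, s))"
    by (rule psd_iff_psd_on) (simp add: flatten_blocks_def)
  also have "\<dots> \<longleftrightarrow> psd_on {..<m * n} (\<lambda>r s. toeplitz_blocks t (?f r) (?f s))"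
  proof -
    have "flatten_blocks m n X $$ (r, s) = toeplitz_blocks t (?f r) (?f s)"
      if "r < m * n" "s < m * n" for r s
      using that assms
      by (simp add: flatten_blocks_def X less_mult_imp_div_less toeplitz_mat_def)
    then have "qf {..<m * n} (\<lambda>r s. flatten_blocks m n X $$ (r, s)) v
      = qf {..<m * n} (\<lambda>r s. toeplitz_blocks t (?f r) (?f s)) v" for v
      by (intro qf_cong) auto
    then show ?thesis by (simp add: psd_on_def)
  qed
  also have "\<dots> \<longleftrightarrow> psd_on ({..<m} \<times> {..<n}) (toeplitz_blocks t)"
    by (rule psd_on_reindex[OF bij_betw_div_mod[OF assms(1)]])
  finally show ?thesis .
qed

section \<open>Rank one positive symbols\<close>

lemma continuous_on_symbol: "continuous_on {z. cmod z = 1} (symbol n a)"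
  unfolding symbol_def by (intro continuous_intros) auto

text \<open>The Laurent coefficients, on the circle, of the polynomial with coefficients
  \<open>v\<close> times the conjugate of the one with coefficients \<open>u\<close>.\<close>

definition autocorrelation :: "nat \<Rightarrow> (nat \<Rightarrow> complex) \<Rightarrow> (nat \<Rightarrow> complex) \<Rightarrow> int \<Rightarrow> complex" where
  "autocorrelation n u v \<kappa> = (\<Sum>k<n. \<Sum>l<n. if \<kappa> = int l - int k then v l * cnj (u k) else 0)"

lemma autocorrelation_in_fr_sequences: "autocorrelation n u v \<in> fr_sequences n"
  unfolding fr_sequences_def autocorrelation_def
  by (auto simp: not_less elim!: sum.not_neutral_contains_not_neutral split: if_splits)

lemma sum_autocorrelation:
  "(\<Sum>\<kappa>\<in>{- int n<..<int n}. autocorrelation n u v \<kappa> * g \<kappa>)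
    = (\<Sum>k<n. \<Sum>l<n. v l * cnj (u k) * g (int l - int k))"
proof -
  have "(\<Sum>\<kappa>\<in>{- int n<..<int n}. autocorrelation n u v \<kappa> * g \<kappa>)
    = (\<Sum>\<kappa>\<in>{- int n<..<int n}. \<Sum>k<n. \<Sum>l<n.
        if \<kappa> = int l - int k then v l * cnj (u k) * g (int l - int k) else 0)"
    unfolding autocorrelation_def sum_distrib_right by (intro sum.cong refl) auto
  also have "\<dots> = (\<Sum>k<n. \<Sum>l<n. \<Sum>\<kappa>\<in>{- int n<..<int n}.
        if \<kappa> = int l - int k then v l * cnj (u k) * g (int l - int k) else 0)"
    by (subst sum.swap, rule sum.cong[OF refl])+ simp
  also have "\<dots> = (\<Sum>k<n. \<Sum>l<n. v l * cnj (u k) * g (int l - int k))"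
    by (intro sum.cong refl) (subst sum.delta, auto)
  finally show ?thesis .
qed

lemma symbol_autocorrelation:
  assumes "cmod z = 1"
  shows "symbol n (autocorrelation n u v) z = (\<Sum>l<n. v l * z ^ l) * cnj (\<Sum>k<n. u k * z ^ k)"
  unfolding symbol_def sum_autocorrelation powi_diff_unit[OF assms]
  by (subst sum.swap) (simp add: sum_product mult_ac)

text \<open>The form at \<open>v\<close> is the squared modulus of the sum of all
  \<open>b i * v i\<close>.\<close>

lemma psd_on_rank_one: "psd_on I (\<lambda>i j. b j * cnj (b i))"
  unfolding psd_on_def
proof
  fix v
  let ?c = "\<Sum>i\<in>I. b i * v i"
  have "qf I (\<lambda>i j. b j * cnj (b i)) v = ?c * cnj ?c"
    unfolding qf_def cnj_sum sum_product by (subst sum.swap) (simp add: mult_ac)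
  also have "\<dots> = of_real ((cmod ?c)\<^sup>2)" by (rule complex_norm_square [symmetric])
  finally show "0 \<le> qf I (\<lambda>i j. b j * cnj (b i)) v"
    by (simp add: less_eq_complex_def)
qed

text \<open>The coefficient at l - k meets t_(k-l), the Toeplitz entry at row k and column l.
  Pairing with rank one symbols thus recovers every value of the block Toeplitz form.\<close>

lemma pairing_autocorrelation:
  "pairing n I (\<lambda>i j. autocorrelation n (\<lambda>k. v (i, k)) (\<lambda>k. v (j, k))) t
    = qf (I \<times> {..<n}) (toeplitz_blocks t) v"
proof -
  have "pairing n I (\<lambda>i j. autocorrelation n (\<lambda>k. v (i, k)) (\<lambda>k. v (j, k))) t
    = (\<Sum>i\<in>I. \<Sum>j\<in>I. \<Sum>k<n. \<Sum>l<n. t i j (int k - int l) * v (j, l) * cnj (v (i, k)))"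
    unfolding pairing_def sum_autocorrelation by (simp add: mult_ac)
  also have "\<dots> = (\<Sum>i\<in>I. \<Sum>k<n. \<Sum>j\<in>I. \<Sum>l<n. t i j (int k - int l) * v (j, l) * cnj (v (i, k)))"
    by (intro sum.cong refl sum.swap)
  finally show ?thesis
    by (simp add: qf_def sum.cartesian_product' split_def)
qed

section \<open>Toeplitz matrices as functionals\<close>

definition toeplitz_coeff :: "complex mat \<Rightarrow> int \<Rightarrow> complex" where
  "toeplitz_coeff T j = (if 0 \<le> j then T $$ (nat j, 0) else T $$ (0, nat (- j)))"

text \<open>The first column carries the coefficients of nonnegative index and the first row the
  others; the bound keeps both positions inside the matrix.\<close>

lemma toeplitz_coeff_toeplitz_mat:
  assumes "\<bar>j\<bar> < int n"
  shows "toeplitz_coeff (toeplitz_mat n t) j = t j"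
  using assms by (auto simp: toeplitz_coeff_def toeplitz_mat_def)

lemma toeplitz_mat_cong:
  assumes "\<And>j. \<bar>j\<bar> < int n \<Longrightarrow> t j = t' j"
  shows "toeplitz_mat n t = toeplitz_mat n t'"
  unfolding toeplitz_mat_def using assms by (intro cong_mat) auto

lemma toeplitz_mat_add: "toeplitz_mat n s + toeplitz_mat n t = toeplitz_mat n (\<lambda>j. s j + t j)"
  by (rule eq_matI) (auto simp: toeplitz_mat_def)

lemma toeplitz_mat_smult: "c \<cdot>\<^sub>m toeplitz_mat n t = toeplitz_mat n (\<lambda>j. c * t j)"
  by (rule eq_matI) (auto simp: toeplitz_mat_def)

definition toeplitz_functional :: "nat \<Rightarrow> complex mat \<Rightarrow> (int \<Rightarrow> complex) \<Rightarrow> complex" where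
  "toeplitz_functional n T =
    (\<lambda>a\<in>fr_sequences n. \<Sum>k\<in>{- int n<..<int n}. a k * toeplitz_coeff T (- k))"

lemma toeplitz_functional_toeplitz_mat:
  assumes "a \<in> fr_sequences n"
  shows "toeplitz_functional n (toeplitz_mat n t) a = (\<Sum>k\<in>{- int n<..<int n}. a k * t (- k))"
  unfolding toeplitz_functional_def using assms
  by (auto simp: toeplitz_coeff_toeplitz_mat intro!: sum.cong)

definition delta :: "int \<Rightarrow> int \<Rightarrow> complex" where
  "delta k = (\<lambda>l. if l = k then 1 else 0)"

lemma delta_in_fr_sequences: "\<bar>k\<bar> < int n \<Longrightarrow> delta k \<in> fr_sequences n"
  by (auto simp: delta_def fr_sequences_def)

text \<open>Evaluation at these sequences recovers all coefficients, which gives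
  injectivity.\<close>

lemma toeplitz_functional_delta:
  assumes "\<bar>j\<bar> < int n"
  shows "toeplitz_functional n (toeplitz_mat n t) (delta (- j)) = t j"
proof -
  have "(\<Sum>k\<in>{- int n<..<int n}. delta (- j) k * t (- k))
    = (\<Sum>k\<in>{- int n<..<int n}. if k = - j then t j else 0)"
    by (intro sum.cong) (auto simp: delta_def)
  also have "\<dots> = t j" using assms by (subst sum.delta) auto
  finally show ?thesis
    using assms by (simp add: toeplitz_functional_toeplitz_mat delta_in_fr_sequences)
qed

text \<open>The sequences \<open>delta k\<close> with |k| < n form a basis. The induction runs over
  truncations of \<open>a\<close> to finite sets.\<close>

lemma functional_expansion:
  assumes "\<psi> \<in> functionals (fejer_riesz_system n)" "a \<in> fr_sequences n"
  shows "\<psi> a = (\<Sum>k\<in>{- int n<..<int n}. a k * \<psi> (delta k))"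
proof -
  have add: "\<psi> (\<lambda>k. a k + b k) = \<psi> a + \<psi> b" if "a \<in> fr_sequences n" "b \<in> fr_sequences n" for a b
    using assms(1) that by (auto simp: functionals_def fejer_riesz_system_def)
  have scale: "\<psi> (\<lambda>k. c * a k) = c * \<psi> a" if "a \<in> fr_sequences n" for a c
    using assms(1) that by (auto simp: functionals_def fejer_riesz_system_def)
  have "\<psi> (\<lambda>k. if k \<in> S then a k else 0) = (\<Sum>k\<in>S. a k * \<psi> (delta k))"
    if "finite S" "S \<subseteq> {- int n<..<int n}" for S
    using that
  proof (induction S rule: finite_induct)
    case empty
    \<comment> \<open>The zero sequence arises as \<open>a\<close> scaled by 0.\<close>
    then show ?case using scale[of a 0] assms(2) by simp
  next
    case (insert s S)
    have fr: "(\<lambda>k. if k \<in> S then a k else 0) \<in> fr_sequences n" "delta s \<in> fr_sequences n"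
      "(\<lambda>k. a s * delta s k) \<in> fr_sequences n"
      using insert.prems assms(2) by (auto simp: fr_sequences_def delta_def)
    have "(\<lambda>k. if k \<in> insert s S then a k else 0)
      = (\<lambda>k. a s * delta s k + (if k \<in> S then a k else 0))"
      using insert.hyps by (auto simp: delta_def fun_eq_iff)
    then show ?case
      using insert fr by (simp add: add scale)
  qed
  from this[of "{- int n<..<int n}"]
  have "\<psi> (\<lambda>k. if k \<in> {- int n<..<int n} then a k else 0) = (\<Sum>k\<in>{- int n<..<int n}. a k * \<psi> (delta k))"
    by simp
  moreover have "(\<lambda>k. if k \<in> {- int n<..<int n} then a k else 0) = a"
    using assms(2) by (fastforce simp: fr_sequences_def fun_eq_iff)
  ultimately show ?thesis by simp
qed

lemma toeplitz_functional_in_functionals: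
  "toeplitz_functional n T \<in> functionals (fejer_riesz_system n)"
proof -
  have "(\<lambda>k. a k + b k) \<in> fr_sequences n" "(\<lambda>k. c * a k) \<in> fr_sequences n"
    if "a \<in> fr_sequences n" "b \<in> fr_sequences n" for a b c
    using that unfolding fr_sequences_def mem_Collect_eq by (metis add_0 mult_zero_right)+
  then show ?thesis
    by (simp add: functionals_def fejer_riesz_system_def toeplitz_functional_def
        distrib_right sum.distrib sum_distrib_left mult.assoc)
qed

lemma toeplitz_functional_surj:
  assumes "\<psi> \<in> functionals (fejer_riesz_system n)"
  shows "toeplitz_functional n (toeplitz_mat n (\<lambda>j. \<psi> (delta (- j)))) = \<psi>"
proof (rule extensionalityI)
  show "toeplitz_functional n (toeplitz_mat n (\<lambda>j. \<psi> (delta (- j)))) \<in> extensional (fr_sequences n)"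
    by (simp add: toeplitz_functional_def)
  show "\<psi> \<in> extensional (fr_sequences n)"
    using assms by (simp add: functionals_def fejer_riesz_system_def)
qed (simp add: toeplitz_functional_toeplitz_mat functional_expansion[OF assms])

lemma toeplitz_functional_bij:
  "bij_betw (toeplitz_functional n) (range (toeplitz_mat n)) (functionals (fejer_riesz_system n))"
  unfolding bij_betw_def
proof
  show "inj_on (toeplitz_functional n) (range (toeplitz_mat n))"
  proof (rule inj_onI, elim imageE)
    fix S T s t
    assume "toeplitz_functional n S = toeplitz_functional n T"
      and "S = toeplitz_mat n s" "T = toeplitz_mat n t"
    then show "S = T"
      using toeplitz_functional_delta[of _ n s] toeplitz_functional_delta[of _ n t]
      by (metis toeplitz_mat_cong)
  qed
  show "toeplitz_functional n ` range (toeplitz_mat n) = functionals (fejer_riesz_system n)"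
  proof (intro subset_antisym image_subsetI subsetI)
    fix \<psi> assume "\<psi> \<in> functionals (fejer_riesz_system n)"
    then show "\<psi> \<in> toeplitz_functional n ` range (toeplitz_mat n)"
      by (subst toeplitz_functional_surj [symmetric]) auto
  qed (rule toeplitz_functional_in_functionals)
qed

lemma toeplitz_functional_add:
  "toeplitz_functional n (toeplitz_mat n (\<lambda>j. s j + t j)) = (\<lambda>a\<in>fr_sequences n.
    toeplitz_functional n (toeplitz_mat n s) a + toeplitz_functional n (toeplitz_mat n t) a)"
proof (rule extensionalityI[where A = "fr_sequences n"])
  fix a assume "a \<in> fr_sequences n"
  then show "toeplitz_functional n (toeplitz_mat n (\<lambda>j. s j + t j)) a = (\<lambda>a\<in>fr_sequences n.
    toeplitz_functional n (toeplitz_mat n s) a + toeplitz_functional n (toeplitz_mat n t) a) a"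
    by (simp add: toeplitz_functional_toeplitz_mat distrib_left sum.distrib)
qed (simp_all add: toeplitz_functional_def)

lemma toeplitz_functional_smult:
  "toeplitz_functional n (toeplitz_mat n (\<lambda>j. c * t j))
    = (\<lambda>a\<in>fr_sequences n. c * toeplitz_functional n (toeplitz_mat n t) a)"
proof (rule extensionalityI[where A = "fr_sequences n"])
  fix a assume "a \<in> fr_sequences n"
  then show "toeplitz_functional n (toeplitz_mat n (\<lambda>j. c * t j)) a
    = (\<lambda>a\<in>fr_sequences n. c * toeplitz_functional n (toeplitz_mat n t) a) a"
    by (simp add: toeplitz_functional_toeplitz_mat sum_distrib_left mult.left_commute)
qed (simp_all add: toeplitz_functional_def)

lemma toeplitz_functional_linear:
  "linear_between (toeplitz_system n) (dual_system (fejer_riesz_system n)) (toeplitz_functional n)"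
proof -
  have "elems (fejer_riesz_system n) = fr_sequences n" by (simp add: fejer_riesz_system_def)
  then show ?thesis
    by (auto simp: linear_between_def toeplitz_system_def dual_system_def toeplitz_functional_in_functionals
        toeplitz_mat_add toeplitz_mat_smult toeplitz_functional_add toeplitz_functional_smult)
qed

section \<open>Positive cones and complete positivity\<close>

lemma sum_toeplitz_functional_eq_pairing:
  assumes "X \<in> mats_over (fr_sequences n) m"
    and "\<And>i j. i < m \<Longrightarrow> j < m \<Longrightarrow> \<Phi> $$ (i, j) = toeplitz_functional n (toeplitz_mat n (t i j))"
  shows "(\<Sum>i<m. \<Sum>j<m. (\<Phi> $$ (i, j)) (X $$ (i, j))) = pairing n {..<m} (\<lambda>i j. X $$ (i, j)) t"
  unfolding pairing_def using assms
  by (intro sum.cong refl) (auto simp: mats_over_def toeplitz_functional_toeplitz_mat)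

text \<open>Symbols are Laurent polynomials, hence continuous on the circle, so the cone comes down
  to pointwise positivity.\<close>

lemma fejer_riesz_pos_cone_iff:
  "X \<in> pos_cone (fejer_riesz_system n) m \<longleftrightarrow> X \<in> mats_over (fr_sequences n) m \<and>
    (\<forall>z. cmod z = 1 \<longrightarrow> psd_on {..<m} (\<lambda>i j. symbol n (X $$ (i, j)) z))"
proof (cases "X \<in> mats_over (fr_sequences n) m")
  case True
  then have X: "X \<in> carrier_mat m m" by (simp add: mats_over_def)
  have "psd (map_mat (\<lambda>f. f z) (map_mat (symbol n) X))
    \<longleftrightarrow> psd_on {..<m} (\<lambda>i j. symbol n (X $$ (i, j)) z)" for z
  proof -
    have "qf {..<m} (\<lambda>i j. map_mat (\<lambda>f. f z) (map_mat (symbol n) X) $$ (i, j)) v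
      = qf {..<m} (\<lambda>i j. symbol n (X $$ (i, j)) z) v" for v
      using X by (intro qf_cong) auto
    then show ?thesis
      using X by (subst psd_iff_psd_on[where d = m]) (auto simp: psd_on_def)
  qed
  moreover have "map_mat (symbol n) X \<in> mats_over {f. continuous_on {z. cmod z = 1} f} m"
    using X by (auto simp: mats_over_def continuous_on_symbol)
  ultimately show ?thesis
    using True by (simp add: fejer_riesz_system_def circle_cone_def)
qed (simp add: fejer_riesz_system_def)

lemma toeplitz_functional_completely_positive:
  assumes "n \<ge> 1"
  shows "completely_positive (toeplitz_system n) (dual_system (fejer_riesz_system n)) (toeplitz_functional n)"
  unfolding completely_positive_def
proof (intro allI ballI)
  fix m T assume "T \<in> pos_cone (toeplitz_system n) m"
  then have T: "T \<in> carrier_mat m m" "\<And>i j. i < m \<Longrightarrow> j < m \<Longrightarrow> T $$ (i, j) \<in> range (toeplitz_mat n)"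
    and psd: "psd (flatten_blocks m n T)"
    by (auto simp: toeplitz_system_def mats_over_def)
  \<comment> \<open>Choice of one coefficient sequence per block turns the matrix over Toeplitz
    matrices into data for \<open>toeplitz_blocks\<close>.\<close>
  have "\<exists>t. \<forall>i j. i < m \<longrightarrow> j < m \<longrightarrow> T $$ (i, j) = toeplitz_mat n (t i j)"
    using T(2) unfolding image_iff by (intro choice allI) metis
  then obtain t where t: "\<And>i j. i < m \<Longrightarrow> j < m \<Longrightarrow> T $$ (i, j) = toeplitz_mat n (t i j)"
    by blast
  show "map_mat (toeplitz_functional n) T \<in> pos_cone (dual_system (fejer_riesz_system n)) m"
    unfolding dual_system_def
  proof (simp, intro conjI ballI)
    show "map_mat (toeplitz_functional n) T \<in> mats_over (functionals (fejer_riesz_system n)) m"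
      using T(1) by (auto simp: mats_over_def toeplitz_functional_in_functionals)
    fix X assume "X \<in> pos_cone (fejer_riesz_system n) m"
    then have X: "X \<in> mats_over (fr_sequences n) m"
      "\<And>z. cmod z = 1 \<Longrightarrow> psd_on {..<m} (\<lambda>i j. symbol n (X $$ (i, j)) z)"
      by (auto simp: fejer_riesz_pos_cone_iff)
    have "(\<Sum>i<m. \<Sum>j<m. (map_mat (toeplitz_functional n) T $$ (i, j)) (X $$ (i, j)))
      = pairing n {..<m} (\<lambda>i j. X $$ (i, j)) t"
      using T(1) t by (intro sum_toeplitz_functional_eq_pairing[OF X(1)]) auto
    also have "\<dots> \<ge> 0"
      using assms psd X(2) psd_flatten_blocks_iff[OF assms t] by (intro pairing_nonneg) auto
    finally show "0 \<le> (\<Sum>i<m. \<Sum>j<m. (map_mat (toeplitz_functional n) T $$ (i, j)) (X $$ (i, j)))" .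
  qed
qed

text \<open>Each value of the block Toeplitz form is the value of the given functional matrix on a
  positive rank one symbol.\<close>

lemma inv_toeplitz_functional_completely_positive:
  assumes "n \<ge> 1"
  shows "completely_positive (dual_system (fejer_riesz_system n)) (toeplitz_system n)
    (inv_into (range (toeplitz_mat n)) (toeplitz_functional n))"
  unfolding completely_positive_def
proof (intro allI ballI)
  fix m \<Phi> assume "\<Phi> \<in> pos_cone (dual_system (fejer_riesz_system n)) m"
  then have \<Phi>: "\<Phi> \<in> carrier_mat m m"
    "\<And>i j. i < m \<Longrightarrow> j < m \<Longrightarrow> \<Phi> $$ (i, j) \<in> functionals (fejer_riesz_system n)"
    and pos: "\<And>X. X \<in> pos_cone (fejer_riesz_system n) m \<Longrightarrow>
      0 \<le> (\<Sum>i<m. \<Sum>j<m. (\<Phi> $$ (i, j)) (X $$ (i, j)))"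
    by (auto simp: dual_system_def mats_over_def)
  let ?inv = "inv_into (range (toeplitz_mat n)) (toeplitz_functional n)"
  \<comment> \<open>The functional pairs index k with t_(-k), hence the reflected argument of
    \<open>delta\<close>.\<close>
  define t where "t i j k = (\<Phi> $$ (i, j)) (delta (- k))" for i j k
  have \<Phi>t: "\<Phi> $$ (i, j) = toeplitz_functional n (toeplitz_mat n (t i j))" if "i < m" "j < m" for i j
    using toeplitz_functional_surj[OF \<Phi>(2)[OF that]] by (simp add: t_def [abs_def])
  have inv: "map_mat ?inv \<Phi> $$ (i, j) = toeplitz_mat n (t i j)" if "i < m" "j < m" for i j
    using that \<Phi>(1) toeplitz_functional_bij[of n] by (auto simp: \<Phi>t bij_betw_def)
  have "psd_on ({..<m} \<times> {..<n}) (toeplitz_blocks t)"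
    unfolding psd_on_def
  proof
    fix v :: "nat \<times> nat \<Rightarrow> complex"
    let ?a = "\<lambda>i j. autocorrelation n (\<lambda>k. v (i, k)) (\<lambda>k. v (j, k))"
    let ?X = "mat m m (\<lambda>(i, j). ?a i j)"
    have X: "?X \<in> mats_over (fr_sequences n) m"
      by (auto simp: mats_over_def autocorrelation_in_fr_sequences)
    have "psd_on {..<m} (\<lambda>i j. symbol n (?X $$ (i, j)) z)" if z: "cmod z = 1" for z
    proof -
      let ?b = "\<lambda>i. \<Sum>l<n. v (i, l) * z ^ l"
      have "qf {..<m} (\<lambda>i j. symbol n (?X $$ (i, j)) z) w = qf {..<m} (\<lambda>i j. ?b j * cnj (?b i)) w" for w
        using z by (intro qf_cong) (auto simp: symbol_autocorrelation)
      then show ?thesis using psd_on_rank_one[of "{..<m}" ?b] by (simp add: psd_on_def)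
    qed
    with X have "0 \<le> (\<Sum>i<m. \<Sum>j<m. (\<Phi> $$ (i, j)) (?X $$ (i, j)))"
      by (intro pos) (simp add: fejer_riesz_pos_cone_iff)
    also have "\<dots> = pairing n {..<m} (\<lambda>i j. ?X $$ (i, j)) t"
      by (rule sum_toeplitz_functional_eq_pairing[OF X \<Phi>t])
    also have "\<dots> = pairing n {..<m} ?a t"
      unfolding pairing_def by (intro sum.cong refl) simp
    also have "\<dots> = qf ({..<m} \<times> {..<n}) (toeplitz_blocks t) v"
      by (rule pairing_autocorrelation)
    finally show "0 \<le> qf ({..<m} \<times> {..<n}) (toeplitz_blocks t) v" .
  qed
  then have "psd (flatten_blocks m n (map_mat ?inv \<Phi>))"
    using psd_flatten_blocks_iff[OF assms inv] by simp
  then show "map_mat ?inv \<Phi> \<in> pos_cone (toeplitz_system n) m"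
    using \<Phi>(1) inv by (auto simp: toeplitz_system_def mats_over_def)
qed

theorem proposition4p6:
  fixes n :: nat
  assumes "n \<ge> 1"
  shows "\<exists>\<phi>. complete_order_iso (toeplitz_system n) (dual_system (fejer_riesz_system n)) \<phi> \<and>
    (\<forall>t. \<forall>a\<in>elems (fejer_riesz_system n).
       \<phi> (toeplitz_mat n t) a = (\<Sum>k\<in>{- int n<..<int n}. a k * t (- k)))"
proof (intro exI conjI)
  have "elems (toeplitz_system n) = range (toeplitz_mat n)"
    "elems (dual_system (fejer_riesz_system n)) = functionals (fejer_riesz_system n)"
    by (simp_all add: toeplitz_system_def dual_system_def)
  then show "complete_order_iso (toeplitz_system n) (dual_system (fejer_riesz_system n)) (toeplitz_functional n)"
    using assms by (simp add: complete_order_iso_def toeplitz_functional_linear toeplitz_functional_bij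
        toeplitz_functional_completely_positive inv_toeplitz_functional_completely_positive)
  show "\<forall>t. \<forall>a\<in>elems (fejer_riesz_system n).
      toeplitz_functional n (toeplitz_mat n t) a = (\<Sum>k\<in>{- int n<..<int n}. a k * t (- k))"
    by (simp add: fejer_riesz_system_def toeplitz_functional_toeplitz_mat)
qed

end
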